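(* Let $N$ be a GA1 number with $\Omega(N)\ge 3$, let $p$ be a prime factor of $N$, and let $r$ be a positive integer with $r\le v_p(N)$. Then $$p\le (r\log N)^{1/r}\le \log N.$$
   Context: For an integer $n>1$ let $G(n)=\dfrac{\sigma(n)}{n\log\log n}$, where $\sigma(n)=\sum_{d\mid n}d$. A GA1 number is a composite integer $N$ such that $G(N)\ge G(N/p)$ for every prime $p$ dividing $N$. $v_p(n)$ is the exponent of the prime $p$ in $n$, and $\Omega(n)=\sum_p v_p(n)$ is the number of prime factors of $n$ counted with multiplicity. *)

theory Defs
  imports Complex_Main "HOL-Computational_Algebra.Primes"
begin

definition sigma :: "nat \<Rightarrow> nat" where
  "sigma n = (\<Sum>d | d dvd n. d)"

(* Meaningful only for n > 1, where ln (ln n) is a nonzero number; it is negative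
   for n = 2. *)
definition G :: "nat \<Rightarrow> real" where
  "G n = real (sigma n) / (real n * ln (ln (real n)))"

definition big_omega :: "nat \<Rightarrow> nat" where
  "big_omega n = (\<Sum>p\<in>prime_factors n. multiplicity p n)"

(* N is composite, so N div p > 1 for every prime p dividing N, and the argument
   of G is always in its intended domain. *)
definition GA1 :: "nat \<Rightarrow> bool" where
  "GA1 N \<longleftrightarrow> N > 1 \<and> \<not> prime N \<and> (\<forall>p. prime p \<and> p dvd N \<longrightarrow> G N \<ge> G (N div p))"

end

theory Submission
  imports Defs "HOL-Analysis.Harmonic_Numbers"
begin

text \<open>
  Write \<open>N = p * M\<close> and \<open>L = ln N\<close>. A divisor of \<open>N\<close> is either \<open>p\<close> times a divisor of \<open>M\<close> or
  a divisor of \<open>N / p^r\<close>, whence \<open>\<sigma>(N) / N \<le> (1 + p^(-r)) * \<sigma>(M) / M\<close>. So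
  \<open>G N \<ge> G M\<close> forces \<open>ln (ln N) \<le> (1 + p^(-r)) * ln (ln M)\<close>. Since \<open>ln (ln N) - ln (ln M) \<ge> ln p / L\<close>,
  this yields \<open>p^r * ln (p^r) < r * L * ln L\<close>, which is impossible if \<open>p^r > r * L\<close>. The second
  inequality amounts to \<open>r \<le> L^(r-1)\<close>, true because \<open>N \<ge> 8\<close> gives \<open>L \<ge> 2\<close>.
\<close>

text \<open>A divisor prime to \<open>p\<close> is coprime to \<open>p ^ Suc k\<close>, hence
  divides \<open>m\<close>; any other is \<open>p\<close> times a divisor of
  \<open>p ^ k * m\<close>. When \<open>p\<close> still divides \<open>m\<close> the two families
  overlap, so only an inequality holds.\<close>

lemma sigma_mult_prime_le:
  assumes "prime p" and "m > 0"
  shows "sigma (p ^ Suc k * m) \<le> p * sigma (p ^ k * m) + sigma m"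
proof -
  let ?M = "p ^ k * m"
  have p0: "p > 0" using assms(1) by (rule prime_gt_0_nat)
  have fin: "finite {d. d dvd ?M}" "finite {d. d dvd m}"
    using assms p0 by simp_all
  have sub: "{d. d dvd p ^ Suc k * m} \<subseteq> (*) p ` {d. d dvd ?M} \<union> {d. d dvd m}"
  proof
    fix d assume "d \<in> {d. d dvd p ^ Suc k * m}"
    then have d: "d dvd p ^ Suc k * m" by simp
    show "d \<in> (*) p ` {d. d dvd ?M} \<union> {d. d dvd m}"
    proof (cases "p dvd d")
      case True
      then obtain e where e: "d = p * e" by blast
      then have "e dvd ?M" using d p0 by (simp add: mult.assoc)
      then show ?thesis using e by blast
    next
      case False
      then have "coprime d (p ^ Suc k)"
        using assms(1) by (metis coprime_commute coprime_power_right_iff prime_imp_coprime)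
      then show ?thesis using d by (simp add: coprime_dvd_mult_right_iff)
    qed
  qed
  have "sigma (p ^ Suc k * m) \<le> \<Sum> ((*) p ` {d. d dvd ?M} \<union> {d. d dvd m})"
    unfolding sigma_def using fin sub by (intro sum_mono2) auto
  also have "\<dots> \<le> \<Sum> ((*) p ` {d. d dvd ?M}) + \<Sum> {d. d dvd m}"
    using fin by (simp add: sum_Un_nat)
  also have "\<Sum> ((*) p ` {d. d dvd ?M}) = p * sigma ?M"
    unfolding sigma_def using p0 by (subst sum.reindex) (auto simp: inj_on_def sum_distrib_left)
  finally show ?thesis by (simp add: sigma_def)
qed

lemma mult_sigma_le_sigma_mult:
  assumes "a > 0" and "m > 0"
  shows "a * sigma m \<le> sigma (a * m)"
proof -
  have "a * sigma m = \<Sum> ((*) a ` {d. d dvd m})"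
    unfolding sigma_def using assms by (subst sum.reindex) (auto simp: inj_on_def sum_distrib_left)
  also have "\<dots> \<le> sigma (a * m)"
    unfolding sigma_def using assms by (intro sum_mono2) auto
  finally show ?thesis .
qed

lemma sigma_pos: "n > 0 \<Longrightarrow> sigma n > 0"
  using mult_sigma_le_sigma_mult[of n 1] by (simp add: sigma_def)

lemma big_omega_eq_size: "big_omega n = size (prime_factorization n)"
  unfolding big_omega_def size_multiset_overloaded_eq
  by (intro sum.cong) (auto simp: count_prime_factorization in_prime_factors_iff)

text \<open>Every prime factor is at least 2. This turns the hypothesis on \<open>big_omega\<close>
  into lower bounds for \<open>N\<close> and \<open>N div p\<close>.\<close>

lemma two_power_big_omega_le:
  assumes "n > 0"
  shows "2 ^ big_omega n \<le> n"
proof -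
  have "2 ^ big_omega n = (\<Prod>p\<in>prime_factors n. 2 ^ multiplicity p n)"
    unfolding big_omega_def by (simp add: power_sum)
  also have "\<dots> \<le> (\<Prod>p\<in>prime_factors n. p ^ multiplicity p n)"
    by (intro prod_mono) (auto intro!: power_mono prime_ge_2_nat simp: in_prime_factors_iff)
  also have "\<dots> = n" using assms by (rule prime_factorization_nat[symmetric])
  finally show ?thesis .
qed

lemma big_omega_mult_prime:
  assumes "prime p" and "n > 0"
  shows "big_omega (p * n) = Suc (big_omega n)"
  using assms prime_gt_0_nat[of p]
  by (simp add: big_omega_eq_size prime_factorization_mult prime_factorization_prime)

lemma prime_power_le_mult_ln:
  fixes p r m :: nat
  defines "N \<equiv> p ^ r * m" and "M \<equiv> p ^ (r - 1) * m"
  assumes p: "prime p" and r: "r \<ge> 1" and M: "M \<ge> 3" and G: "G M \<le> G N"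
  shows "real p ^ r \<le> real r * ln (real N)"
proof (rule ccontr)
  let ?P = "real p ^ r" and ?L = "ln (real N)" and ?K = "ln (real M)"
  assume "\<not> ?P \<le> real r * ?L"
  then have gt: "?P > real r * ?L" by simp
  have p2: "p \<ge> 2" using p by (rule prime_ge_2_nat)
  have m: "m > 0" using M by (auto simp: M_def intro: gr0I)
  have NM: "N = p * M" using r by (cases r) (simp_all add: N_def M_def)
  \<comment> \<open>Since 3 > e, both double logarithms are positive, so the denominators in
    \<open>G\<close> can be cleared without reversing the inequality.\<close>
  have K: "?K > 1"
    using M by (intro less_le_trans[OF ln3_gt_1]) simp
  have LK: "?L = ln (real p) + ?K"
    using p2 M by (simp add: NM ln_mult)
  have lnp: "ln (real p) > 0" using p2 by simp
  have L: "?L > 1" using K LK lnp by linarith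
  have "p ^ (r - 1) * sigma m \<le> sigma M"
    unfolding M_def using m p2 by (intro mult_sigma_le_sigma_mult) auto
  then have "p * (p ^ (r - 1) * sigma m) \<le> p * sigma M" by (rule mult_le_mono2)
  then have 1: "p ^ r * sigma m \<le> p * sigma M"
    using r by (cases r) (simp_all add: mult.assoc)
  have 2: "sigma N \<le> p * sigma M + sigma m"
    using sigma_mult_prime_le[OF p m, of "r - 1"] r by (simp add: N_def M_def)
  \<comment> \<open>Scale \<open>2\<close> by \<open>p ^ r\<close> and absorb the term in
    \<open>sigma m\<close> using \<open>1\<close>: this is the factor 1 + p^(-r), free of
    division.\<close>
  have "p ^ r * sigma N \<le> (p ^ r + 1) * (p * sigma M)"
    using mult_le_mono2[OF 2, of "p ^ r"] 1 by (simp add: algebra_simps)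
  then have "real (p ^ r * sigma N) \<le> real ((p ^ r + 1) * (p * sigma M))"
    by (simp only: of_nat_le_iff)
  then have s: "?P * real (sigma N) \<le> (?P + 1) * (real p * real (sigma M))"
    by (simp add: algebra_simps)
  have "real (sigma M) * real p * ln ?L \<le> real (sigma N) * ln ?K"
  proof -
    have "real (sigma M) / (real M * ln ?K) \<le> real (sigma N) / (real p * real M * ln ?L)"
      using G by (simp add: G_def NM)
    then show ?thesis
      using K L M p2 by (simp add: field_simps)
  qed
  then have "?P * (real (sigma M) * real p * ln ?L) \<le> ?P * (real (sigma N) * ln ?K)"
    using p2 by (intro mult_left_mono) auto
  also have "\<dots> \<le> (?P + 1) * (real p * real (sigma M)) * ln ?K"
    using mult_right_mono[OF s, of "ln ?K"] K by (simp add: mult.assoc)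
  finally have "(real p * real (sigma M)) * (?P * ln ?L) \<le> (real p * real (sigma M)) * ((?P + 1) * ln ?K)"
    by (simp add: algebra_simps)
  then have a: "?P * ln ?L \<le> (?P + 1) * ln ?K"
    using p2 M sigma_pos[of M] by (subst (asm) mult_le_cancel_left_pos) auto
  \<comment> \<open>Apply ln x \<le> x - 1 at x = K / L, where 1 - K / L = ln p / L.\<close>
  have "ln ?K - ln ?L = ln (?K / ?L)" using K L by (simp add: ln_div)
  also have "\<dots> \<le> ?K / ?L - 1" using K L by (intro ln_le_minus_one) simp
  also have "\<dots> = - (ln (real p) / ?L)" using L LK by (simp add: field_simps)
  finally have "ln (real p) / ?L \<le> ln ?L - ln ?K" by simp
  then have "?P * (ln (real p) / ?L) \<le> ?P * (ln ?L - ln ?K)"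
    by (intro mult_left_mono) auto
  also have "\<dots> \<le> ln ?K" using a by (simp add: algebra_simps)
  \<comment> \<open>Strictness enters here, from K < L; it is what contradicts the non-strict bound
    below.\<close>
  also have "\<dots> < ln ?L" using K LK lnp by simp
  finally have "?P * ln (real p) < ln ?L * ?L" using L by (simp add: field_simps)
  then have "real r * (?P * ln (real p)) < real r * (ln ?L * ?L)"
    using r by (intro mult_strict_left_mono) auto
  \<comment> \<open>Multiply r L < P by ln L \<le> ln P = r ln p; the latter holds because r \<ge> 1
    gives L \<le> r L < P.\<close>
  moreover have "real r * ?L * ln ?L \<le> ?P * (real r * ln (real p))"
  proof -
    have "?L \<le> real r * ?L" using r L by simp
    then have "?L \<le> ?P" using gt by linarith
    then have "ln ?L \<le> ln ?P" using L p2 by (subst ln_le_cancel_iff) auto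
    also have "ln ?P = real r * ln (real p)" using p2 by (simp add: ln_realpow)
    finally show ?thesis using gt L by (intro mult_mono) auto
  qed
  ultimately show False by (simp add: algebra_simps)
qed

lemma of_nat_le_power_pred:
  fixes x :: real
  assumes "x \<ge> 2"
  shows "real r \<le> x ^ (r - 1)"
proof (cases r)
  case (Suc k)
  \<comment> \<open>This is k < 2^k. The case r = 0, where \<open>r - 1\<close> truncates to 0,
    reads 0 \<le> 1.\<close>
  have "Suc k \<le> 2 ^ k" by (simp add: Suc_leI)
  then have "real (Suc k) \<le> 2 ^ k"
    by (metis of_nat_le_iff of_nat_numeral of_nat_power)
  also have "\<dots> \<le> x ^ k" using assms by (intro power_mono) auto
  finally show ?thesis using Suc by simp
qed simp

theorem theorem9:
  fixes N p r :: nat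
  assumes "GA1 N"
    and "big_omega N \<ge> 3"
    and "prime p" and "p dvd N"
    and "r \<ge> 1" and "r \<le> multiplicity p N"
  shows "real p \<le> (real r * ln (real N)) powr (1 / real r)
    \<and> (real r * ln (real N)) powr (1 / real r) \<le> ln (real N)"
proof -
  let ?L = "ln (real N)"
  have N0: "N > 0" using assms(1) by (simp add: GA1_def)
  have p0: "p > 0" using assms(3) by (rule prime_gt_0_nat)
  have "p ^ r dvd N" using assms(6) by (rule multiplicity_dvd')
  then obtain m where m: "N = p ^ r * m" by blast
  have NM: "N = p * (p ^ (r - 1) * m)" using m assms(5) by (cases r) (simp_all add: mult.assoc)
  define M where "M = p ^ (r - 1) * m"
  have M0: "M > 0" using NM N0 by (auto simp: M_def intro!: gr0I)
  \<comment> \<open>Removing one prime factor lowers \<open>big_omega\<close> by 1, so M \<ge>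
    4.\<close>
  have "big_omega M \<ge> 2"
    using big_omega_mult_prime[OF assms(3) M0] assms(2) NM by (simp add: M_def)
  then have "(2::nat) ^ 2 \<le> 2 ^ big_omega M" by (intro power_increasing) auto
  also have "\<dots> \<le> M" using M0 by (rule two_power_big_omega_le)
  finally have M3: "M \<ge> 3" by simp
  have "N div p = M" using NM p0 by (simp add: M_def)
  then have "G M \<le> G N" using assms(1,3,4) by (auto simp: GA1_def)
  then have P: "real p ^ r \<le> real r * ?L"
    using prime_power_le_mult_ln[OF assms(3,5), of m] M3 m by (simp add: M_def)
  \<comment> \<open>The bound ln 2 \<ge> 2/3 gives ln 8 = 3 ln 2 \<ge> 2.\<close>
  have "(2::nat) ^ 3 \<le> 2 ^ big_omega N" using assms(2) by (intro power_increasing) auto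
  also have "\<dots> \<le> N" using N0 by (rule two_power_big_omega_le)
  finally have "real N \<ge> 2 ^ 3" by simp
  then have "ln (2 ^ 3) \<le> ?L" using N0 by (subst ln_le_cancel_iff) auto
  moreover have "ln (2 ^ 3 :: real) = 3 * ln 2" by (subst ln_realpow) auto
  ultimately have L: "?L \<ge> 2" using ln2_ge_two_thirds by linarith
  \<comment> \<open>Taking r-th roots is monotone, so it suffices to compare p^r \<le> r L \<le>
    L^r.\<close>
  have root: "(x ^ r) powr (1 / real r) = x" if "x > 0" for x :: real
    using that assms(5) by (simp add: powr_powr flip: powr_realpow)
  have "real p = (real p ^ r) powr (1 / real r)" using root p0 by simp
  also have "\<dots> \<le> (real r * ?L) powr (1 / real r)"
    using P by (intro powr_mono2) auto
  finally have lower: "real p \<le> (real r * ?L) powr (1 / real r)" .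
  have "real r * ?L \<le> ?L ^ (r - 1) * ?L"
    using of_nat_le_power_pred[OF L] L by (intro mult_right_mono) auto
  also have "\<dots> = ?L ^ r" using assms(5) by (cases r) simp_all
  finally have "(real r * ?L) powr (1 / real r) \<le> (?L ^ r) powr (1 / real r)"
    using L by (intro powr_mono2) auto
  also have "\<dots> = ?L" using L by (intro root) simp
  finally show ?thesis using lower by blast
qed

end
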